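(* Let $a$ and $b$ be co-prime integers with $1<a<b$, and let $u=u_{(a,b)}$ and $v=v_{(a,b)}$ be the sequences defined by $u_0=v_0=\phi_{(a,b)}(1)$ and, for $i\in\mathbb{N}$, $$(u_{i+1},v_{i+1})=\begin{cases}(u_i,\,u_iv_i)&\text{if }u_iv_i<a,\\ (\tfrac1a u_iv_i,\,v_i)&\text{if }a\le u_iv_i.\end{cases}$$ Then both sequences converge, and $$\lim_{i\to+\infty}u_i=1\quad\text{and}\quad\lim_{i\to+\infty}v_i=a.$$
   Context: $\mathbb{N}=\{0,1,2,\dots\}$. For co-prime integers $1<a<b$ and $p\in\mathbb{N}$, $\phi_{(a,b)}(p)=a^q/b^p$ where $q=\lceil p\log b/\log a\rceil$ is the smallest nonnegative integer with $1\le a^q/b^p$. In particular $\phi_{(a,b)}(1)=a^{\lceil \log b/\log a\rceil}/b$. *)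

theory Defs
  imports Complex_Main
begin

definition phi_exp :: "int \<Rightarrow> int \<Rightarrow> nat \<Rightarrow> nat" where
  "phi_exp a b p = nat \<lceil>real p * ln (real_of_int b) / ln (real_of_int a)\<rceil>"

definition phi :: "int \<Rightarrow> int \<Rightarrow> nat \<Rightarrow> real" where
  "phi a b p = real_of_int a ^ phi_exp a b p / real_of_int b ^ p"

lemma phi_exp_eq_Least:
  assumes "1 < a" "a < b"
  shows "phi_exp a b p = (LEAST q. 1 \<le> real_of_int a ^ q / real_of_int b ^ p)"
proof -
  have a: "real_of_int a > 1" and b: "real_of_int b > 1"
    using assms by auto
  have *: "1 \<le> real_of_int a ^ q / real_of_int b ^ p \<longleftrightarrow> phi_exp a b p \<le> q" for q
  proof -
    have "1 \<le> real_of_int a ^ q / real_of_int b ^ p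
        \<longleftrightarrow> ln (real_of_int b ^ p) \<le> ln (real_of_int a ^ q)"
      using a b by simp
    also have "\<dots> \<longleftrightarrow> real p * ln (real_of_int b) \<le> real q * ln (real_of_int a)"
      using a b by (simp add: ln_realpow)
    also have "\<dots> \<longleftrightarrow> real p * ln (real_of_int b) / ln (real_of_int a) \<le> real q"
      using a by (simp add: pos_divide_le_eq)
    also have "\<dots> \<longleftrightarrow> phi_exp a b p \<le> q"
      unfolding phi_exp_def by (simp add: nat_le_iff ceiling_le_iff)
    finally show ?thesis .
  qed
  show ?thesis
    unfolding * by (rule Least_equality [symmetric]) auto
qed

primrec uv :: "int \<Rightarrow> int \<Rightarrow> nat \<Rightarrow> real \<times> real" where
  "uv a b 0 = (phi a b 1, phi a b 1)"
| "uv a b (Suc i) =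
    (let (x, y) = uv a b i in
      if x * y < real_of_int a then (x, x * y) else (1 / real_of_int a * (x * y), y))"

definition u_seq :: "int \<Rightarrow> int \<Rightarrow> nat \<Rightarrow> real" where
  "u_seq a b i = fst (uv a b i)"

definition v_seq :: "int \<Rightarrow> int \<Rightarrow> nat \<Rightarrow> real" where
  "v_seq a b i = snd (uv a b i)"

end

(* The sequence u decreases, v increases, and 1 < u, v < a throughout, so both converge, say to U and V.
   Strictness of 1 < u comes from coprimality: no product of powers of a and b with a nontrivial power
   of b in it equals 1. If U \<noteq> 1, then v (Suc i) = u i * v i fails for large i, so from some
   index N on only u is updated; then U = U * v N / a, contradicting v N < a. If V \<noteq> a, then
   from some index M on only v is updated, so U = u M > 1, a contradiction. *)

theory Submission
  imports Defs
begin

text \<open>The factor \<open>a ^ l\<close> allows negative powers of \<open>a\<close>, so that the set is closed under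
  division by \<open>a\<close>.\<close>

definition pow_quotients :: "int \<Rightarrow> int \<Rightarrow> real set" where
  "pow_quotients a b =
    {x. \<exists>l m n. 0 < m \<and> x * real_of_int a ^ l * real_of_int b ^ m = real_of_int a ^ n}"

lemma pow_quotients_mult:
  assumes "x \<in> pow_quotients a b" "y \<in> pow_quotients a b"
  shows "x * y \<in> pow_quotients a b"
proof -
  obtain l m n where x: "0 < m" "x * real_of_int a ^ l * real_of_int b ^ m = real_of_int a ^ n"
    using assms(1) unfolding pow_quotients_def by blast
  obtain l' m' n' where y: "y * real_of_int a ^ l' * real_of_int b ^ m' = real_of_int a ^ n'"
    using assms(2) unfolding pow_quotients_def by blast
  have "x * y * real_of_int a ^ (l + l') * real_of_int b ^ (m + m') = real_of_int a ^ (n + n')"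
    unfolding power_add x(2)[symmetric] y[symmetric] by (simp add: mult_ac)
  with x(1) show ?thesis
    unfolding pow_quotients_def by (metis (mono_tags, lifting) add_gr_0 mem_Collect_eq)
qed

lemma pow_quotients_divide:
  assumes "x \<in> pow_quotients a b" "a \<noteq> 0"
  shows "x / real_of_int a \<in> pow_quotients a b"
proof -
  obtain l m n where x: "0 < m" "x * real_of_int a ^ l * real_of_int b ^ m = real_of_int a ^ n"
    using assms(1) unfolding pow_quotients_def by blast
  have "x / real_of_int a * real_of_int a ^ Suc l * real_of_int b ^ m = real_of_int a ^ n"
    using x(2) assms(2) by simp
  with x(1) show ?thesis
    unfolding pow_quotients_def by blast
qed

text \<open>Since \<open>0 < m\<close>, membership of \<open>1\<close> would make \<open>b\<close>
  divide a power of \<open>a\<close>. Coprimality would then force \<open>b\<close> to be a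
  unit.\<close>

lemma one_notin_pow_quotients:
  assumes "coprime a b" "1 < b"
  shows "1 \<notin> pow_quotients a b"
proof
  assume "1 \<in> pow_quotients a b"
  then obtain l m n where m: "0 < m" and
    "real_of_int a ^ l * real_of_int b ^ m = real_of_int a ^ n"
    unfolding pow_quotients_def by auto
  then have "real_of_int (a ^ l * b ^ m) = real_of_int (a ^ n)"
    by simp
  then have "a ^ l * b ^ m = a ^ n"
    by (simp only: of_int_eq_iff)
  moreover have "b dvd a ^ l * b ^ m"
    using m by (intro dvd_mult) (simp add: dvd_power)
  ultimately have "b dvd a ^ n"
    by simp
  moreover have "coprime b (a ^ n)"
    using assms(1) by (simp add: coprime_commute)
  ultimately have "is_unit b"
    by (meson coprime_common_divisor dvd_refl)
  with assms(2) show False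
    by simp
qed

text \<open>The exponent \<open>q\<close> is positive because \<open>1 < b\<close>, and minimal, so
  its predecessor satisfies \<open>a ^ r < b\<close>. Multiplying by \<open>a\<close> gives the
  upper bound.\<close>

lemma phi_one_bounds:
  assumes "1 < a" "a < b"
  shows "1 \<le> phi a b 1" "phi a b 1 < real_of_int a"
proof -
  define P where "P q \<longleftrightarrow> 1 \<le> real_of_int a ^ q / real_of_int b ^ 1" for q
  define q where "q = (LEAST q. P q)"
  have phi: "phi a b 1 = real_of_int a ^ q / real_of_int b"
    unfolding phi_def phi_exp_eq_Least[OF assms] q_def P_def by simp
  \<comment> \<open>Some exponent must satisfy \<open>P\<close> before anything can be concluded
    from \<open>LEAST\<close>.\<close>
  obtain n where "real_of_int b < real_of_int a ^ n"
    using real_arch_pow[of "real_of_int a" "real_of_int b"] assms(1) by (metis of_int_1_less_iff)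
  then have "P n"
    using assms by (simp add: P_def)
  then have Pq: "P q"
    unfolding q_def by (rule LeastI)
  then show "1 \<le> phi a b 1"
    unfolding phi by (simp add: P_def)
  have "\<not> P 0"
    using assms by (simp add: P_def)
  with Pq obtain r where r: "q = Suc r"
    by (cases q) auto
  have "\<not> P r"
    by (rule not_less_Least) (use r in \<open>simp add: q_def\<close>)
  then have "real_of_int a ^ r < real_of_int b"
    using assms by (simp add: P_def)
  then show "phi a b 1 < real_of_int a"
    unfolding phi r using assms by (simp add: divide_less_eq)
qed

lemma phi_in_pow_quotients:
  assumes "b \<noteq> 0" "0 < p"
  shows "phi a b p \<in> pow_quotients a b"
proof -
  have "phi a b p * real_of_int a ^ 0 * real_of_int b ^ p = real_of_int a ^ phi_exp a b p"
    using assms(1) by (simp add: phi_def)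
  with assms(2) show ?thesis
    unfolding pow_quotients_def by blast
qed

lemma uv_step:
  "(u_seq a b (Suc i), v_seq a b (Suc i)) =
    (if u_seq a b i * v_seq a b i < real_of_int a
     then (u_seq a b i, u_seq a b i * v_seq a b i)
     else (u_seq a b i * v_seq a b i / real_of_int a, v_seq a b i))"
  by (simp add: u_seq_def v_seq_def split_beta Let_def)

text \<open>The bounds alone do not reproduce themselves: when \<open>a \<le> x * y\<close>, they
  yield only \<open>1 \<le> x * y / a\<close>. Membership in \<open>pow_quotients\<close> is carried
  along to exclude equality, both here and at the start.\<close>

lemma uv_invariant:
  assumes "coprime a b" "1 < a" "a < b"
  shows "u_seq a b i \<in> pow_quotients a b \<inter> {1<..<real_of_int a} \<and>
         v_seq a b i \<in> pow_quotients a b \<inter> {1<..<real_of_int a}"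
proof (induction i)
  case 0
  have "phi a b 1 \<in> pow_quotients a b"
    using assms by (intro phi_in_pow_quotients) auto
  moreover have "phi a b 1 \<noteq> 1"
    using calculation one_notin_pow_quotients[of a b] assms by auto
  ultimately show ?case
    using phi_one_bounds[OF assms(2,3)] by (simp add: u_seq_def v_seq_def)
next
  case (Suc i)
  define x y where "x = u_seq a b i" and "y = v_seq a b i"
  have x: "x \<in> pow_quotients a b" "1 < x" "x < real_of_int a"
    and y: "y \<in> pow_quotients a b" "1 < y" "y < real_of_int a"
    using Suc.IH by (auto simp: x_def y_def)
  have xy: "x * y \<in> pow_quotients a b"
    using x(1) y(1) by (rule pow_quotients_mult)
  show ?case
  proof (cases "x * y < real_of_int a")
    case True
    then have "u_seq a b (Suc i) = x" "v_seq a b (Suc i) = x * y"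
      using uv_step[of a b i] by (simp_all add: x_def y_def)
    moreover have "1 < x * y"
      using x(2) y(2) by (rule less_1_mult)
    ultimately show ?thesis
      using True x y xy by simp
  next
    case False
    then have eq: "u_seq a b (Suc i) = x * y / real_of_int a" "v_seq a b (Suc i) = y"
      using uv_step[of a b i] by (simp_all add: x_def y_def)
    have in_pq: "x * y / real_of_int a \<in> pow_quotients a b"
      using xy assms by (intro pow_quotients_divide) auto
    moreover have "1 \<notin> pow_quotients a b"
      using assms by (intro one_notin_pow_quotients) auto
    ultimately have "x * y / real_of_int a \<noteq> 1"
      by metis
    moreover have "1 \<le> x * y / real_of_int a"
      using False assms(2) by simp
    moreover have "x * y < real_of_int a * real_of_int a"
      using x y by (intro mult_strict_mono) auto
    then have "x * y / real_of_int a < real_of_int a"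
      using assms(2) by (simp add: divide_less_eq)
    ultimately show ?thesis
      using in_pq y by (simp add: eq)
  qed
qed

text \<open>Once one sequence is no longer updated, its limit is a value that it attains, to which
  the strict bounds apply.\<close>

lemma eventually_Suc_eq_imp_eventually_const:
  assumes "eventually (\<lambda>i. f (Suc i) = f i) sequentially"
  obtains N where "eventually (\<lambda>i. f i = f N) sequentially"
proof -
  obtain N where N: "\<And>i. i \<ge> N \<Longrightarrow> f (Suc i) = f i"
    using assms unfolding eventually_sequentially by blast
  have "f i = f N" if "i \<ge> N" for i
    using that by (induction i rule: dec_induct) (auto simp: N)
  then show thesis
    using that eventually_sequentially by blast
qed

theorem theorem6p2:
  fixes a b :: int
  assumes "coprime a b" and "1 < a" and "a < b"
  shows "u_seq a b \<longlonglongrightarrow> 1 \<and> v_seq a b \<longlonglongrightarrow> real_of_int a"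
proof -
  define u v A where "u = u_seq a b" and "v = v_seq a b" and "A = real_of_int a"
  have A: "1 < A"
    using assms(2) by (simp add: A_def)
  have bounds: "1 < u i" "u i < A" "1 < v i" "v i < A" for i
    using uv_invariant[OF assms, of i] by (auto simp: u_def v_def A_def)
  \<comment> \<open>The conditions of the case split are dropped: the limit argument uses only that
    one of the two updates takes place.\<close>
  have step: "u (Suc i) = u i \<and> v (Suc i) = u i * v i \<or>
              u (Suc i) = u i * v i / A \<and> v (Suc i) = v i" for i
    using uv_step[of a b i] by (auto simp: u_def v_def A_def split: if_splits)
  \<comment> \<open>These follow from \<open>v i < A\<close> and \<open>1 < u i\<close>, so either
    update respects both monotonicities.\<close>
  have "u i * v i / A \<le> u i" "v i \<le> u i * v i" for i
    using bounds[of i] A by (simp_all add: divide_le_eq)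
  then have mono: "u (Suc i) \<le> u i" "v i \<le> v (Suc i)" for i
    using step[of i] by (metis order_refl)+
  obtain U where U: "u \<longlonglongrightarrow> U"
    using decseq_convergent[OF decseq_SucI, of u 1] mono(1) bounds(1) by (metis less_imp_le)
  obtain V where V: "v \<longlonglongrightarrow> V"
    using incseq_convergent[OF incseq_SucI, of v A] mono(2) bounds(4) by (metis less_imp_le)
  have U1: "1 \<le> U"
    by (rule LIMSEQ_le_const[OF U]) (use bounds(1) less_imp_le in blast)
  have V1: "1 \<le> V"
    by (rule LIMSEQ_le_const[OF V]) (use bounds(3) less_imp_le in blast)
  note Suc_lims = LIMSEQ_Suc[OF U] LIMSEQ_Suc[OF V]
  have "U = 1"
  proof (rule ccontr)
    assume "U \<noteq> 1"
    \<comment> \<open>This difference vanishes whenever \<open>v\<close> is multiplied by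
      \<open>u i\<close>. Its limit \<open>V * (1 - U)\<close> is nonzero, so eventually only the
      other update occurs.\<close>
    have "(\<lambda>i. v (Suc i) - u i * v i) \<longlonglongrightarrow> V - U * V"
      by (intro tendsto_intros U V Suc_lims)
    moreover have "V - U * V \<noteq> 0"
      using \<open>U \<noteq> 1\<close> V1 by simp
    ultimately have "eventually (\<lambda>i. v (Suc i) - u i * v i \<noteq> 0) sequentially"
      by (rule tendsto_imp_eventually_ne)
    then have ev: "eventually (\<lambda>i. u (Suc i) = u i * v i / A \<and> v (Suc i) = v i) sequentially"
      by (rule eventually_mono) (use step in auto)
    then have "eventually (\<lambda>i. v (Suc i) = v i) sequentially"
      by (rule eventually_mono) simp
    then obtain N where N: "eventually (\<lambda>i. v i = v N) sequentially"
      by (rule eventually_Suc_eq_imp_eventually_const)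
    have "V = v N"
      using tendsto_cong[OF N, of V] V by (simp add: LIMSEQ_const_iff)
    moreover have "(\<lambda>i. u i * v i / A) \<longlonglongrightarrow> U * V / A"
      using A by (intro tendsto_intros U V) auto
    moreover have "(\<lambda>i. u i * v i / A) \<longlonglongrightarrow> U"
      by (rule Lim_transform_eventually[OF Suc_lims(1) eventually_mono[OF ev]]) simp
    ultimately have "U * v N / A = U"
      using LIMSEQ_unique by blast
    \<comment> \<open>Cancelling the positive \<open>U\<close> would give
      \<open>v N = A\<close>.\<close>
    with U1 A bounds(4)[of N] show False
      by (simp add: field_simps)
  qed
  moreover have "V = A"
  proof (rule ccontr)
    assume "V \<noteq> A"
    \<comment> \<open>The mirror image: the difference vanishes at each update of \<open>u\<close>,
      while its limit is \<open>U * (1 - V / A)\<close>.\<close>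
    have "(\<lambda>i. u (Suc i) - u i * v i / A) \<longlonglongrightarrow> U - U * V / A"
      using A by (intro tendsto_intros U V Suc_lims) auto
    moreover have "U - U * V / A \<noteq> 0"
      using \<open>V \<noteq> A\<close> U1 A by (simp add: field_simps)
    ultimately have "eventually (\<lambda>i. u (Suc i) - u i * v i / A \<noteq> 0) sequentially"
      by (rule tendsto_imp_eventually_ne)
    then have ev: "eventually (\<lambda>i. u (Suc i) = u i \<and> v (Suc i) = u i * v i) sequentially"
      by (rule eventually_mono) (use step in auto)
    then have "eventually (\<lambda>i. u (Suc i) = u i) sequentially"
      by (rule eventually_mono) simp
    then obtain M where M: "eventually (\<lambda>i. u i = u M) sequentially"
      by (rule eventually_Suc_eq_imp_eventually_const)
    have "U = u M"
      using tendsto_cong[OF M, of U] U by (simp add: LIMSEQ_const_iff)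
    \<comment> \<open>The strict bound \<open>1 < u M\<close> is essential here: the limit
      \<open>1\<close> would be attained at \<open>M\<close>.\<close>
    with \<open>U = 1\<close> bounds(1)[of M] show False
      by simp
  qed
  ultimately show ?thesis
    using U V by (simp add: u_def v_def A_def)
qed

end
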